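(* Let $(Y_t)_{t\ge0}$ be the CBC-process with parameters $(b,c,\mu,g)$, with transition semigroup $(P_t)_{t\ge0}$ and killed transition semigroup $(P_t^0)_{t\ge0}$. Suppose that $(P_t)_{t\ge0}$ has the strong Feller property, i.e. for every $t>0$ and every bounded Borel function $f$ on $[0,\infty)$ the map $x\mapsto P_tf(x)$ is continuous on $[0,\infty)$. Then $(P_t^0)_{t\ge0}$ has the weak Feller property: for a measure-separable class $\mathcal A$ of continuous bounded functions $f$ with support contained in $(0,\infty)$, the map $x\mapsto P_t^0f(x)$ is continuous on $(0,\infty)$ (for every $f\in\mathcal A$ and every $t\geq 0$).
   Context: Setting. Let $b\in\mathbb R$, $c\ge 0$, let $\mu$ be a measure on $(0,\infty)$ such that $(1\wedge z^2)\mu(dz)$ is a finite measure, and let $g:[0,\infty)\to[0,\infty)$ be continuous and non-decreasing with $g(0)=0$. On a filtered probability space satisfying the usual hypotheses, let $W(ds,du)$ be a Gaussian white noise on $(0,\infty)^2$ based on $ds\,du$, $M(ds,dz,du)$ a Poisson random measure on $(0,\infty)^3$ with intensity $ds\,\mu(dz)\,du$, and $\tilde M$ the compensated measure of $M$ (both noises relative to the given filtration). The CBC-process (continuous-state branching process with competition) $(Y_t)_{t\ge0}$ is the $[0,\infty)$-valued strong solution to $$Y_t=Y_0+\sqrt{2c}\int_0^t\!\int_0^{Y_{s-}}W(ds,du)-\int_0^t[bY_s+g(Y_s)]ds+\int_0^t\!\int_0^1\!\int_0^{Y_{s-}}z\,\tilde M(ds,dz,du)+\int_0^t\!\int_1^\infty\!\int_0^{Y_{s-}}z\,M(ds,dz,du).$$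 Standing assumption: this equation has a unique non-explosive strong solution. The state $0$ is absorbing. Let $\tau_0^-:=\inf\{t\ge0:Y_t=0\}$ ($\inf\emptyset=\infty$). The transition semigroup is $P_tf(x)=\mathbb E_x[f(Y_t)]$, and the killed transition semigroup is $P_t^0f(x)=\mathbb E_x[\mathbf 1_{\{t<\tau_0^-\}}f(Y_t)]$, $x\in(0,\infty)$. A class $\mathcal A$ of bounded continuous functions is measure-separable if any two finite measures $\nu_1,\nu_2$ on $(0,\infty)$ with $\int f\,d\nu_1=\int f\,d\nu_2$ for all $f\in\mathcal A$ coincide. *)

theory Defs
  imports "HOL-Probability.Probability"
begin

section \<open>Filtrations and paths\<close>

text \<open>The time index of a filtration is \<open>real\<close>, as required by the library locale \<open>filtration\<close>;
  only times \<open>t \<ge> 0\<close> matter (a filtration on \<open>[0,\<infinity>)\<close> is extended by any smaller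
  sigma-algebras to negative times). The condition on null sets makes \<open>P\<close> complete.\<close>

definition usual_hypotheses :: "'w measure \<Rightarrow> (real \<Rightarrow> 'w measure) \<Rightarrow> bool" where
  "usual_hypotheses P F \<longleftrightarrow>
     filtration (space P) F \<and>
     (\<forall>t. sets (F t) \<subseteq> sets P) \<and>
     (\<forall>N\<in>null_sets P. \<forall>A\<subseteq>N. A \<in> sets (F 0)) \<and>
     (\<forall>t\<ge>0. sets (F t) = (\<Inter>s\<in>{t<..}. sets (F s)))"

definition adapted :: "(real \<Rightarrow> 'w measure) \<Rightarrow> (real \<Rightarrow> 'w \<Rightarrow> real) \<Rightarrow> bool" where
  "adapted F X \<longleftrightarrow> (\<forall>t\<ge>0. X t \<in> borel_measurable (F t))"

definition left_lim :: "(real \<Rightarrow> real) \<Rightarrow> real \<Rightarrow> real" where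
  "left_lim y s = Lim (at_left s) y"

definition cadlag :: "(real \<Rightarrow> real) \<Rightarrow> bool" where
  "cadlag y \<longleftrightarrow>
     (\<forall>t\<ge>0. (y \<longlongrightarrow> y t) (at_right t)) \<and> (\<forall>t>0. \<exists>l. (y \<longlongrightarrow> l) (at_left t))"

section \<open>Noises\<close>

text \<open>Noises live on \<open>(0,\<infinity>) \<times> E\<close> with base measure \<open>ds \<otimes> E\<close>, where the mark space \<open>E\<close> is
  \<open>du\<close> on \<open>(0,\<infinity>)\<close> for the white noise and \<open>\<mu>(dz) du\<close> on \<open>(0,\<infinity>)\<^sup>2\<close> for the Poisson
  random measure.\<close>

definition leb_pos :: "real measure" where
  "leb_pos = restrict_space lborel {0<..}"

definition base :: "'e measure \<Rightarrow> (real \<times> 'e) measure" where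
  "base E = leb_pos \<Otimes>\<^sub>M E"

definition finite_sets :: "'a measure \<Rightarrow> 'a set set" where
  "finite_sets L = {B \<in> sets L. emeasure L B < \<infinity>}"

definition noise_events ::
    "'w measure \<Rightarrow> ('a set \<Rightarrow> 'w \<Rightarrow> 'b::topological_space) \<Rightarrow> 'a set set \<Rightarrow> 'w set set" where
  "noise_events P Z \<B> = {Z B -` S \<inter> space P | B S. B \<in> \<B> \<and> S \<in> sets borel}"

definition noise_relative_to ::
    "'w measure \<Rightarrow> (real \<Rightarrow> 'w measure) \<Rightarrow> 'e measure \<Rightarrow>
     ((real \<times> 'e) set \<Rightarrow> 'w \<Rightarrow> 'b::topological_space) \<Rightarrow> bool" where
  "noise_relative_to P F E Z \<longleftrightarrow>
     (\<forall>t\<ge>0.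
        (\<forall>B \<in> finite_sets (base E). B \<subseteq> {0<..t} \<times> UNIV \<longrightarrow> Z B \<in> borel_measurable (F t)) \<and>
        prob_space.indep_set P (sets (F t))
          (sigma_sets (space P)
             (noise_events P Z {B \<in> finite_sets (base E). B \<subseteq> {t<..} \<times> UNIV})))"

definition independently_scattered ::
    "'w measure \<Rightarrow> 'a measure \<Rightarrow> ('a set \<Rightarrow> 'w \<Rightarrow> 'b::topological_space) \<Rightarrow> bool" where
  "independently_scattered P L Z \<longleftrightarrow>
     (\<forall>\<B>. finite \<B> \<and> \<B> \<subseteq> finite_sets L \<and> disjoint \<B>
        \<longrightarrow> prob_space.indep_vars P (\<lambda>_. borel) Z \<B>)"

text \<open>The value of the noise is a random variable for each set of finite base measure; sets of base
  measure 0 are separated out because \<open>normal_density\<close> is degenerate for variance 0.\<close>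

definition gaussian_white_noise ::
    "'w measure \<Rightarrow> (real \<Rightarrow> 'w measure) \<Rightarrow> 'e measure \<Rightarrow>
     ((real \<times> 'e) set \<Rightarrow> 'w \<Rightarrow> real) \<Rightarrow> bool" where
  "gaussian_white_noise P F E W \<longleftrightarrow>
     (\<forall>B \<in> finite_sets (base E). W B \<in> borel_measurable P \<and>
        (if emeasure (base E) B = 0 then (AE \<omega> in P. W B \<omega> = 0)
         else distributed P lborel (W B) (normal_density 0 (sqrt (measure (base E) B))))) \<and>
     (\<forall>A \<in> finite_sets (base E). \<forall>B \<in> finite_sets (base E). A \<inter> B = {} \<longrightarrow>
        (AE \<omega> in P. W (A \<union> B) \<omega> = W A \<omega> + W B \<omega>)) \<and>
     independently_scattered P (base E) W \<and>
     noise_relative_to P F E W"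

definition poisson_random_measure ::
    "'w measure \<Rightarrow> (real \<Rightarrow> 'w measure) \<Rightarrow> 'e measure \<Rightarrow>
     ('w \<Rightarrow> (real \<times> 'e) measure) \<Rightarrow> bool" where
  "poisson_random_measure P F E M \<longleftrightarrow>
     (\<forall>\<omega>\<in>space P. sets (M \<omega>) = sets (base E)) \<and>
     (\<forall>B \<in> sets (base E). (\<lambda>\<omega>. emeasure (M \<omega>) B) \<in> borel_measurable P) \<and>
     (\<forall>B \<in> finite_sets (base E). \<forall>k::nat.
        measure P {\<omega> \<in> space P. emeasure (M \<omega>) B = of_nat k} =
          exp (- measure (base E) B) * measure (base E) B ^ k / fact k) \<and>
     independently_scattered P (base E) (\<lambda>B \<omega>. emeasure (M \<omega>) B) \<and>
     noise_relative_to P F E (\<lambda>B \<omega>. emeasure (M \<omega>) B)"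

definition compensated ::
    "'e measure \<Rightarrow> ('w \<Rightarrow> (real \<times> 'e) measure) \<Rightarrow> (real \<times> 'e) set \<Rightarrow> 'w \<Rightarrow> real" where
  "compensated E M B \<omega> = measure (M \<omega>) B - measure (base E) B"

section \<open>Stochastic integrals\<close>

text \<open>A list of quadruples \<open>(\<xi>, a, b, A)\<close> stands for the elementary integrand
  \<open>\<Sum> \<xi>(\<omega>) 1\<^bsub>(a,b]\<^esub>(s) 1\<^bsub>A\<^esub>(e)\<close>.\<close>

type_synonym ('w, 'e) elementary = "(('w \<Rightarrow> real) \<times> real \<times> real \<times> 'e set) list"

definition elementary_integrand ::
    "'w measure \<Rightarrow> (real \<Rightarrow> 'w measure) \<Rightarrow> 'e measure \<Rightarrow> ('w, 'e) elementary \<Rightarrow> bool" where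
  "elementary_integrand P F E h \<longleftrightarrow>
     (\<forall>(\<xi>, a, b, A) \<in> set h. 0 \<le> a \<and> a \<le> b \<and> \<xi> \<in> borel_measurable (F a) \<and>
        bounded (\<xi> ` space P) \<and> A \<in> finite_sets E)"

definition elementary_fun :: "('w, 'e) elementary \<Rightarrow> 'w \<Rightarrow> real \<times> 'e \<Rightarrow> real" where
  "elementary_fun h \<omega> p = (\<Sum>(\<xi>, a, b, A)\<leftarrow>h. \<xi> \<omega> * indicator ({a<..b} \<times> A) p)"

definition elementary_integral ::
    "((real \<times> 'e) set \<Rightarrow> 'w \<Rightarrow> real) \<Rightarrow> ('w, 'e) elementary \<Rightarrow> real \<Rightarrow> 'w \<Rightarrow> real" where
  "elementary_integral Z h t \<omega> =
     (\<Sum>(\<xi>, a, b, A)\<leftarrow>h. \<xi> \<omega> * Z ({min a t<..min b t} \<times> A) \<omega>)"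

definition predictable_sigma ::
    "'w measure \<Rightarrow> (real \<Rightarrow> 'w measure) \<Rightarrow> 'e measure \<Rightarrow> ('w \<times> real \<times> 'e) measure" where
  "predictable_sigma P F E = sigma (space P \<times> {0<..} \<times> space E)
     {G \<times> {a<..b} \<times> A | G a b A. 0 \<le> a \<and> a \<le> b \<and> G \<in> sets (F a) \<and> A \<in> sets E}"

definition sq_dist ::
    "'e measure \<Rightarrow> real \<Rightarrow> (real \<times> 'e \<Rightarrow> real) \<Rightarrow> (real \<times> 'e \<Rightarrow> real) \<Rightarrow> ennreal" where
  "sq_dist E t h k = (\<integral>\<^sup>+ p. ennreal ((h p - k p)\<^sup>2) * indicator ({0<..t} \<times> UNIV) p \<partial>base E)"

text \<open>\<open>X\<close> is a version of the integral process \<open>t \<mapsto> \<integral>\<^sub>0\<^sup>t \<integral> H(s,e) Z(ds,de)\<close> of a predictable,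
  locally square-integrable \<open>H\<close>: a limit in probability of integrals of elementary integrands that
  approximate \<open>H\<close> in \<open>L\<^sup>2\<close>(\<open>base E\<close>) in probability on bounded time intervals. Since \<open>X\<close> is cadlag,
  it is determined up to indistinguishability. Here \<open>Z\<close> is a white noise or a compensated Poisson
  random measure.\<close>

definition stochastic_integral ::
    "'w measure \<Rightarrow> (real \<Rightarrow> 'w measure) \<Rightarrow> 'e measure \<Rightarrow> ((real \<times> 'e) set \<Rightarrow> 'w \<Rightarrow> real) \<Rightarrow>
     ('w \<Rightarrow> real \<times> 'e \<Rightarrow> real) \<Rightarrow> (real \<Rightarrow> 'w \<Rightarrow> real) \<Rightarrow> bool" where
  "stochastic_integral P F E Z H X \<longleftrightarrow>
     (\<lambda>(\<omega>, p). H \<omega> p) \<in> borel_measurable (predictable_sigma P F E) \<and>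
     (\<forall>t\<ge>0. AE \<omega> in P. sq_dist E t (H \<omega>) (\<lambda>_. 0) < \<infinity>) \<and>
     adapted F X \<and>
     (\<forall>\<omega>\<in>space P. cadlag (\<lambda>t. X t \<omega>)) \<and>
     (\<exists>h :: nat \<Rightarrow> ('w, 'e) elementary.
        (\<forall>n. elementary_integrand P F E (h n)) \<and>
        (\<forall>t\<ge>0. \<forall>\<epsilon>>0.
           (\<lambda>n. measure P {\<omega> \<in> space P.
              ennreal \<epsilon> \<le> sq_dist E t (elementary_fun (h n) \<omega>) (H \<omega>)}) \<longlonglongrightarrow> 0 \<and>
           (\<lambda>n. measure P {\<omega> \<in> space P.
              \<epsilon> \<le> \<bar>elementary_integral Z (h n) t \<omega> - X t \<omega>\<bar>}) \<longlonglongrightarrow> 0))"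

section \<open>CBC-processes\<close>

definition cbc_parameters :: "real \<Rightarrow> real measure \<Rightarrow> (real \<Rightarrow> real) \<Rightarrow> bool" where
  "cbc_parameters c \<mu> g \<longleftrightarrow>
     c \<ge> 0 \<and>
     sets \<mu> = sets (restrict_space borel {0<..}) \<and>
     (\<integral>\<^sup>+ z. ennreal (min 1 (z\<^sup>2)) \<partial>\<mu>) < \<infinity> \<and>
     continuous_on {0..} g \<and> mono_on {0..} g \<and> g 0 = 0 \<and> (\<forall>x\<ge>0. g x \<ge> 0)"

text \<open>A mark is \<open>u\<close> for the white noise and \<open>(z, u)\<close> for the Poisson random measure. The integrals
  over \<open>z\<close> are taken over \<open>(0,1]\<close> and \<open>(1,\<infinity>)\<close>. Values being real, solutions are non-explosive.
  The integral of the large jumps is a pathwise Lebesgue integral, whose existence is required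
  explicitly because the library integral of a non-integrable function is 0.\<close>

definition cbc_solution ::
    "'w measure \<Rightarrow> (real \<Rightarrow> 'w measure) \<Rightarrow> real \<Rightarrow> real \<Rightarrow> real measure \<Rightarrow> (real \<Rightarrow> real) \<Rightarrow>
     ((real \<times> real) set \<Rightarrow> 'w \<Rightarrow> real) \<Rightarrow> ('w \<Rightarrow> (real \<times> real \<times> real) measure) \<Rightarrow>
     real \<Rightarrow> (real \<Rightarrow> 'w \<Rightarrow> real) \<Rightarrow> bool" where
  "cbc_solution P F b c \<mu> g W M x Y \<longleftrightarrow>
     adapted F Y \<and>
     (\<forall>\<omega>\<in>space P. cadlag (\<lambda>t. Y t \<omega>) \<and> (\<forall>t\<ge>0. Y t \<omega> \<ge> 0)) \<and>
     (AE \<omega> in P. Y 0 \<omega> = x) \<and>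
     (\<exists>I J.
        stochastic_integral P F leb_pos W
          (\<lambda>\<omega> (s, u). if u \<le> left_lim (\<lambda>r. Y r \<omega>) s then 1 else 0) I \<and>
        stochastic_integral P F (\<mu> \<Otimes>\<^sub>M leb_pos) (compensated (\<mu> \<Otimes>\<^sub>M leb_pos) M)
          (\<lambda>\<omega> (s, z, u). if z \<le> 1 \<and> u \<le> left_lim (\<lambda>r. Y r \<omega>) s then z else 0) J \<and>
        (AE \<omega> in P. \<forall>t\<ge>0.
           let k = (\<lambda>(s, z, u).
                 if s \<le> t \<and> 1 < z \<and> u \<le> left_lim (\<lambda>r. Y r \<omega>) s then z else 0)
           in integrable (M \<omega>) k \<and>
              Y t \<omega> = Y 0 \<omega> + sqrt (2 * c) * I t \<omega>
                - (LBINT s:{0..t}. b * Y s \<omega> + g (Y s \<omega>))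
                + J t \<omega> + (\<integral>p. k p \<partial>M \<omega>)))"

text \<open>The augmented (complete and right-continuous) filtration generated by the two noises. The
  initial values below are deterministic, so they do not contribute.\<close>

definition noise_filtration ::
    "'w measure \<Rightarrow> real measure \<Rightarrow> ((real \<times> real) set \<Rightarrow> 'w \<Rightarrow> real) \<Rightarrow>
     ('w \<Rightarrow> (real \<times> real \<times> real) measure) \<Rightarrow> real \<Rightarrow> 'w measure" where
  "noise_filtration P \<mu> W M t = sigma (space P)
     (\<Inter>s\<in>{t<..}. sigma_sets (space P)
        (noise_events P W {B \<in> finite_sets (base leb_pos). B \<subseteq> {0<..s} \<times> UNIV} \<union>
         noise_events P (\<lambda>B \<omega>. emeasure (M \<omega>) B)
           {B \<in> finite_sets (base (\<mu> \<Otimes>\<^sub>M leb_pos)). B \<subseteq> {0<..s} \<times> UNIV} \<union>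
         null_sets P))"

definition cbc_unique_strong_solution ::
    "'w measure \<Rightarrow> (real \<Rightarrow> 'w measure) \<Rightarrow> real \<Rightarrow> real \<Rightarrow> real measure \<Rightarrow> (real \<Rightarrow> real) \<Rightarrow>
     ((real \<times> real) set \<Rightarrow> 'w \<Rightarrow> real) \<Rightarrow> ('w \<Rightarrow> (real \<times> real \<times> real) measure) \<Rightarrow>
     real \<Rightarrow> (real \<Rightarrow> 'w \<Rightarrow> real) \<Rightarrow> bool" where
  "cbc_unique_strong_solution P F b c \<mu> g W M x Y \<longleftrightarrow>
     cbc_solution P F b c \<mu> g W M x Y \<and>
     adapted (noise_filtration P \<mu> W M) Y \<and>
     (\<forall>Y'. cbc_solution P F b c \<mu> g W M x Y' \<longrightarrow> (AE \<omega> in P. \<forall>t\<ge>0. Y' t \<omega> = Y t \<omega>))"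

section \<open>Semigroups and Feller properties\<close>

text \<open>In the following, \<open>Y x\<close> is the process started from \<open>x\<close>, so that the expectation of a functional
  of the process under the law with starting point \<open>x\<close> is the expectation of the functional of
  \<open>Y x\<close>.\<close>

definition hitting_time_zero :: "(real \<Rightarrow> 'w \<Rightarrow> real) \<Rightarrow> 'w \<Rightarrow> ereal" where
  "hitting_time_zero X \<omega> = Inf (ereal ` {t. t \<ge> 0 \<and> X t \<omega> = 0})"

definition transition_semigroup ::
    "'w measure \<Rightarrow> (real \<Rightarrow> real \<Rightarrow> 'w \<Rightarrow> real) \<Rightarrow> real \<Rightarrow> (real \<Rightarrow> real) \<Rightarrow> real \<Rightarrow> real" where
  "transition_semigroup P Y t f x = (\<integral>\<omega>. f (Y x t \<omega>) \<partial>P)"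

definition killed_semigroup ::
    "'w measure \<Rightarrow> (real \<Rightarrow> real \<Rightarrow> 'w \<Rightarrow> real) \<Rightarrow> real \<Rightarrow> (real \<Rightarrow> real) \<Rightarrow> real \<Rightarrow> real" where
  "killed_semigroup P Y t f x =
     (\<integral>\<omega>. indicator {\<omega>. ereal t < hitting_time_zero (Y x) \<omega>} \<omega> * f (Y x t \<omega>) \<partial>P)"

definition strong_feller :: "(real \<Rightarrow> (real \<Rightarrow> real) \<Rightarrow> real \<Rightarrow> real) \<Rightarrow> bool" where
  "strong_feller Q \<longleftrightarrow>
     (\<forall>t>0. \<forall>f. f \<in> borel_measurable (restrict_space borel {0..}) \<and> bounded (f ` {0..})
        \<longrightarrow> continuous_on {0..} (Q t f))"

definition measure_separable :: "(real \<Rightarrow> real) set \<Rightarrow> bool" where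
  "measure_separable \<A> \<longleftrightarrow>
     (\<forall>\<nu>1 \<nu>2. finite_measure \<nu>1 \<and> finite_measure \<nu>2 \<and>
        sets \<nu>1 = sets (restrict_space borel {0<..}) \<and>
        sets \<nu>2 = sets (restrict_space borel {0<..}) \<and>
        (\<forall>f\<in>\<A>. (\<integral>x. f x \<partial>\<nu>1) = (\<integral>x. f x \<partial>\<nu>2))
        \<longrightarrow> \<nu>1 = \<nu>2)"

text \<open>Functions on \<open>(0,\<infinity>)\<close> with support in \<open>(0,\<infinity>)\<close> are extended by 0; the support is closed
  in \<open>\<real>\<close>, so such a function vanishes near 0.\<close>

definition weak_feller :: "(real \<Rightarrow> (real \<Rightarrow> real) \<Rightarrow> real \<Rightarrow> real) \<Rightarrow> bool" where
  "weak_feller Q \<longleftrightarrow>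
     (\<exists>\<A>. measure_separable \<A> \<and>
        (\<forall>f\<in>\<A>. continuous_on {0<..} f \<and> bounded (f ` {0<..}) \<and> closure {x. f x \<noteq> 0} \<subseteq> {0<..}) \<and>
        (\<forall>f\<in>\<A>. \<forall>t\<ge>0. continuous_on {0<..} (Q t f)))"

end

theory Submission
  imports Defs
begin

text \<open>A right-continuous path absorbed at \<open>0\<close> has been killed by time \<open>t\<close> exactly when it
  sits at \<open>0\<close> at time \<open>t\<close>. Hence for a
  function \<open>f\<close> with \<open>f 0 = 0\<close> killing changes nothing: \<open>f (Y\<^sub>t)\<close> already vanishes on the event
  \<open>\<tau>\<^sub>0\<^sup>- \<le> t\<close>, and \<open>P\<^sub>t\<^sup>0 f = P\<^sub>t f\<close> (\<open>killed_semigroup_eq_transition_semigroup\<close>). A continuous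
  function on \<open>(0,\<infinity>)\<close> whose support stays away from \<open>0\<close> extends by \<open>0\<close> to a function of this kind.
  For \<open>t > 0\<close> the strong Feller property makes \<open>P\<^sub>t f\<close> continuous; for \<open>t = 0\<close>, where it says
  nothing, \<open>P\<^sub>0\<^sup>0 f = f\<close> on \<open>(0,\<infinity>)\<close>.

  The class \<open>\<A>\<close> can therefore consist of all bounded continuous functions supported in \<open>(0,\<infinity>)\<close>. It
  separates measures because continuous ramps supported in \<open>(a,\<infinity>)\<close>, \<open>a \<ge> 0\<close>, approximate the
  indicators of these half-lines, which determine a finite measure on \<open>(0,\<infinity>)\<close>
  (\<open>measure_separable_pos_test_functions\<close>).\<close>

section \<open>Test functions supported in the open half-line\<close>

definition pos_test_functions :: "(real \<Rightarrow> real) set" where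
  "pos_test_functions =
     {f. continuous_on {0<..} f \<and> bounded (f ` {0<..}) \<and> closure {x. f x \<noteq> 0} \<subseteq> {0<..}}"

lemma pos_test_function_nonpos:
  assumes "f \<in> pos_test_functions" "x \<le> 0"
  shows "f x = 0"
proof (rule ccontr)
  assume "f x \<noteq> 0"
  then have "x \<in> closure {x. f x \<noteq> 0}"
    by (intro subsetD[OF closure_subset]) simp
  moreover have "closure {x. f x \<noteq> 0} \<subseteq> {0<..}"
    using assms(1) by (simp add: pos_test_functions_def)
  ultimately have "x \<in> {0<..}"
    by blast
  then show False
    using assms(2) by simp
qed

lemma pos_test_function_borel:
  assumes "f \<in> pos_test_functions"
  shows "f \<in> borel_measurable borel"
proof -
  have "(\<lambda>x. if x \<in> {0<..} then f x else 0) \<in> borel_measurable borel"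
    using assms by (intro borel_measurable_continuous_on_if) (auto simp: pos_test_functions_def)
  moreover have "(\<lambda>x. if x \<in> {0<..} then f x else 0) = f"
    using pos_test_function_nonpos[OF assms] by (auto simp: fun_eq_iff)
  ultimately show ?thesis
    by simp
qed

lemma pos_test_function_bounded:
  assumes "f \<in> pos_test_functions"
  shows "bounded (range f)"
proof -
  have "range f \<subseteq> insert 0 (f ` {0<..})"
  proof
    fix y assume "y \<in> range f"
    then obtain x where "y = f x"
      by blast
    then show "y \<in> insert 0 (f ` {0<..})"
      using pos_test_function_nonpos[OF assms, of x] by (cases "x \<le> 0") auto
  qed
  moreover have "bounded (insert 0 (f ` {0<..}))"
    using assms by (simp add: pos_test_functions_def)
  ultimately show ?thesis
    by (rule bounded_subset[rotated])
qed

text \<open>The shift by \<open>- 1\<close> makes the ramp vanish up to \<open>a + 1 / (n + 1)\<close>, so that even for \<open>a = 0\<close> its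
  support is bounded away from \<open>0\<close>.\<close>

definition ramp :: "real \<Rightarrow> nat \<Rightarrow> real \<Rightarrow> real" where
  "ramp a n x = min 1 (max 0 (real (Suc n) * (x - a) - 1))"

lemma continuous_on_ramp: "continuous_on S (ramp a n)"
  unfolding ramp_def by (intro continuous_intros)

lemma ramp_bounds: "0 \<le> ramp a n x" "ramp a n x \<le> 1"
  by (auto simp: ramp_def)

lemma ramp_pos_test_function:
  assumes "a \<ge> 0"
  shows "ramp a n \<in> pos_test_functions"
proof -
  have "{x. ramp a n x \<noteq> 0} \<subseteq> {a + 1 / real (Suc n)..}"
    by (auto simp: ramp_def field_simps split: if_splits)
  then have "closure {x. ramp a n x \<noteq> 0} \<subseteq> {a + 1 / real (Suc n)..}"
    by (intro closure_minimal) auto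
  moreover have "0 < a + 1 / real (Suc n)"
    using assms by (simp add: add_nonneg_pos)
  ultimately have "closure {x. ramp a n x \<noteq> 0} \<subseteq> {0<..}"
    by (meson atLeast_iff greaterThan_iff less_le_trans subset_iff)
  moreover have "bounded (ramp a n ` {0<..})"
    using ramp_bounds[of a n] by (intro boundedI[of _ 1]) auto
  ultimately show ?thesis
    by (simp add: pos_test_functions_def continuous_on_ramp)
qed

lemma ramp_tendsto_indicator:
  "(\<lambda>n. ramp a n x) \<longlonglongrightarrow> indicator {a<..} x"
proof (cases "x > a")
  case True
  obtain N :: nat where N: "2 / (x - a) < real N"
    using reals_Archimedean2 by blast
  have "ramp a n x = 1" if "n \<ge> N" for n
  proof -
    have "2 \<le> real N * (x - a)"
      using N True by (simp add: field_simps)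
    also have "\<dots> \<le> real (Suc n) * (x - a)"
      using that True by (intro mult_right_mono) auto
    finally show ?thesis
      by (simp add: ramp_def)
  qed
  then have "eventually (\<lambda>n. ramp a n x = 1) sequentially"
    by (auto simp: eventually_sequentially)
  then show ?thesis
    using True by (simp add: tendsto_eventually)
next
  case False
  then have "real (Suc n) * (x - a) \<le> 0" for n
    by (intro mult_nonneg_nonpos) auto
  then have "ramp a n x = 0" for n
    by (smt (verit) ramp_def)
  then show ?thesis
    using False by simp
qed

text \<open>The measures are transported to the whole line, where half-lines \<open>(a,\<infinity>)\<close> determine a finite
  measure; a negative \<open>a\<close> may be replaced by \<open>0\<close>.\<close>

lemma measure_separable_pos_test_functions: "measure_separable pos_test_functions"
  unfolding measure_separable_def
proof (intro allI impI, elim conjE)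
  fix \<nu>1 \<nu>2 :: "real measure"
  assume fin: "finite_measure \<nu>1" "finite_measure \<nu>2"
    and sets: "sets \<nu>1 = sets (restrict_space borel {0<..})"
      "sets \<nu>2 = sets (restrict_space borel {0<..})"
    and eq: "\<forall>f\<in>pos_test_functions. (\<integral>x. f x \<partial>\<nu>1) = (\<integral>x. f x \<partial>\<nu>2)"
  have id_meas: "(\<lambda>x. x) \<in> measurable \<nu> borel"
    and space_eq: "space \<nu> = {0<..}"
    if "sets \<nu> = sets (restrict_space borel {0<..})" for \<nu> :: "real measure"
  proof -
    show "(\<lambda>x. x) \<in> measurable \<nu> borel"
      unfolding measurable_cong_sets[OF that refl] by (rule measurable_restrict_space1) simp
    show "space \<nu> = {0<..}"
      using sets_eq_imp_space_eq[OF that] by (simp add: space_restrict_space)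
  qed
  have limit: "(\<lambda>n. \<integral>x. ramp (max 0 a) n x \<partial>\<nu>) \<longlonglongrightarrow> measure (distr \<nu> borel (\<lambda>x. x)) {a<..}"
    if \<nu>: "finite_measure \<nu>" "sets \<nu> = sets (restrict_space borel {0<..})"
    for \<nu> :: "real measure" and a :: real
  proof -
    interpret finite_measure \<nu>
      by fact
    have ramp_meas: "ramp (max 0 a) n \<in> borel_measurable \<nu>" for n
      using measurable_compose[OF id_meas[OF \<nu>(2)]
          borel_measurable_continuous_onI[OF continuous_on_ramp]] by simp
    have half_line: "{max 0 a<..} = {a<..} \<inter> space \<nu>"
      unfolding space_eq[OF \<nu>(2)] by (rule set_eqI) auto
    have half_line_sets: "{max 0 a<..} \<in> sets \<nu>"
      using measurable_sets[OF id_meas[OF \<nu>(2)], of "{a<..}"] by (simp add: half_line)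
    have "(\<lambda>n. \<integral>x. ramp (max 0 a) n x \<partial>\<nu>) \<longlonglongrightarrow> (\<integral>x. indicator {max 0 a<..} x \<partial>\<nu>)"
      using ramp_bounds half_line_sets
      by (intro integral_dominated_convergence[where w = "\<lambda>_. 1"] AE_I2
          ramp_tendsto_indicator ramp_meas) auto
    also have "(\<integral>x. indicator {max 0 a<..} x \<partial>\<nu>) = measure \<nu> {max 0 a<..}"
      unfolding half_line by (simp add: Int_assoc)
    also have "\<dots> = measure (distr \<nu> borel (\<lambda>x. x)) {a<..}"
      unfolding half_line using id_meas[OF \<nu>(2)] by (simp add: measure_distr)
    finally show ?thesis .
  qed
  have distr_eq: "distr \<nu>1 borel (\<lambda>x. x) = distr \<nu>2 borel (\<lambda>x. x)"
  proof (rule measure_eqI_lessThan)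
    interpret D1: finite_measure "distr \<nu>1 borel (\<lambda>x. x)"
      using fin(1) id_meas[OF sets(1)] by (rule finite_measure.finite_measure_distr)
    interpret D2: finite_measure "distr \<nu>2 borel (\<lambda>x. x)"
      using fin(2) id_meas[OF sets(2)] by (rule finite_measure.finite_measure_distr)
    fix a :: real
    show "emeasure (distr \<nu>1 borel (\<lambda>x. x)) {a<..} < \<infinity>"
      by (simp add: less_top[symmetric])
    have "(\<integral>x. ramp (max 0 a) n x \<partial>\<nu>1) = (\<integral>x. ramp (max 0 a) n x \<partial>\<nu>2)" for n
      using eq ramp_pos_test_function[of "max 0 a" n] by simp
    then have "measure (distr \<nu>1 borel (\<lambda>x. x)) {a<..} = measure (distr \<nu>2 borel (\<lambda>x. x)) {a<..}"
      using limit[OF fin(1) sets(1), of a] limit[OF fin(2) sets(2), of a]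
      by (auto intro: LIMSEQ_unique)
    then show "emeasure (distr \<nu>1 borel (\<lambda>x. x)) {a<..} = emeasure (distr \<nu>2 borel (\<lambda>x. x)) {a<..}"
      by (simp add: D1.emeasure_eq_measure D2.emeasure_eq_measure)
  qed simp_all
  show "\<nu>1 = \<nu>2"
  proof (rule measure_eqI)
    show "sets \<nu>1 = sets \<nu>2"
      using sets by simp
    fix A assume "A \<in> sets \<nu>1"
    then have A: "A \<in> sets borel" "A \<subseteq> {0<..}"
      using sets by (auto simp: sets_restrict_space)
    have "emeasure \<nu> A = emeasure (distr \<nu> borel (\<lambda>x. x)) A"
      if "sets \<nu> = sets (restrict_space borel {0<..})" for \<nu> :: "real measure"
      using A id_meas[OF that] space_eq[OF that]
      by (simp add: emeasure_distr Int_absorb2)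
    then show "emeasure \<nu>1 A = emeasure \<nu>2 A"
      using sets distr_eq by simp
  qed
qed

section \<open>Killing at an absorbing state\<close>

text \<open>Right-continuity gives the strict inequality: if the path is nonzero at time \<open>t\<close>, it stays
  nonzero for a while after \<open>t\<close>.\<close>

lemma less_hitting_time_zero_iff:
  assumes cadlag: "cadlag (\<lambda>t. X t \<omega>)"
    and absorbing: "\<forall>s\<ge>0. \<forall>t\<ge>s. X s \<omega> = 0 \<longrightarrow> X t \<omega> = 0"
    and "t \<ge> 0"
  shows "ereal t < hitting_time_zero X \<omega> \<longleftrightarrow> X t \<omega> \<noteq> 0"
proof
  assume less: "ereal t < hitting_time_zero X \<omega>"
  show "X t \<omega> \<noteq> 0"
  proof
    assume "X t \<omega> = 0"
    then have "hitting_time_zero X \<omega> \<le> ereal t"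
      unfolding hitting_time_zero_def using \<open>t \<ge> 0\<close> by (intro Inf_lower) auto
    then show False
      using less by simp
  qed
next
  assume nz: "X t \<omega> \<noteq> 0"
  have "((\<lambda>t. X t \<omega>) \<longlongrightarrow> X t \<omega>) (at_right t)"
    using cadlag \<open>t \<ge> 0\<close> by (simp add: cadlag_def)
  then have "eventually (\<lambda>s. X s \<omega> \<noteq> 0) (at_right t)"
    using nz by (rule tendsto_imp_eventually_ne)
  then obtain r where r: "r > t" "\<And>s. t < s \<Longrightarrow> s < r \<Longrightarrow> X s \<omega> \<noteq> 0"
    unfolding eventually_at_right_field by blast
  have "ereal r \<le> hitting_time_zero X \<omega>"
    unfolding hitting_time_zero_def
  proof (rule Inf_greatest, clarify)
    fix s assume s: "s \<ge> 0" "X s \<omega> = 0"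
    have "\<not> s \<le> t"
      using absorbing s nz by blast
    then show "ereal r \<le> ereal s"
      using r(2)[of s] s by force
  qed
  then show "ereal t < hitting_time_zero X \<omega>"
    using r(1) by (meson ereal_less(2) less_ereal.simps(1) less_le_trans)
qed

lemma usual_hypotheses_complete:
  assumes "usual_hypotheses P F"
  shows "complete_measure P"
proof
  fix A N assume "A \<subseteq> N" "N \<in> null_sets P"
  then have "A \<in> sets (F 0)" "sets (F 0) \<subseteq> sets P"
    using assms unfolding usual_hypotheses_def by blast+
  then show "A \<in> sets P"
    by blast
qed

lemma adapted_borel_measurable:
  assumes "usual_hypotheses P F" "adapted F X" "t \<ge> 0"
  shows "X t \<in> borel_measurable P"
proof -
  have "filtration (space P) F" "sets (F t) \<subseteq> sets P"
    using assms(1) unfolding usual_hypotheses_def by blast+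
  then have "subalgebra P (F t)"
    by (simp add: subalgebra_def filtration.space_F)
  moreover have "X t \<in> borel_measurable (F t)"
    using assms(2,3) by (simp add: adapted_def)
  ultimately show ?thesis
    by (rule measurable_from_subalg)
qed

lemma cbc_solutionD:
  assumes "cbc_solution P F b c \<mu> g W M x Y"
  shows "adapted F Y"
    and "\<forall>\<omega>\<in>space P. cadlag (\<lambda>t. Y t \<omega>) \<and> (\<forall>t\<ge>0. Y t \<omega> \<ge> 0)"
    and "AE \<omega> in P. Y 0 \<omega> = x"
proof -
  note sol = assms[unfolded cbc_solution_def]
  show "adapted F Y"
    using sol by (rule conjunct1)
  show "\<forall>\<omega>\<in>space P. cadlag (\<lambda>t. Y t \<omega>) \<and> (\<forall>t\<ge>0. Y t \<omega> \<ge> 0)"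
    using sol[THEN conjunct2] by (rule conjunct1)
  show "AE \<omega> in P. Y 0 \<omega> = x"
    using sol[THEN conjunct2, THEN conjunct2] by (rule conjunct1)
qed

text \<open>Completeness of \<open>P\<close> makes the survival event measurable: up to a null set it is the event that
  \<open>Y x t\<close> is nonzero. Without measurability, almost sure equality need not give equal
  integrals.\<close>

lemma killed_semigroup_eq_transition_semigroup:
  assumes complete: "complete_measure P"
    and meas: "Y x t \<in> borel_measurable P"
    and cadlag: "\<And>\<omega>. \<omega> \<in> space P \<Longrightarrow> cadlag (\<lambda>t. Y x t \<omega>)"
    and absorbing: "AE \<omega> in P. \<forall>s\<ge>0. \<forall>t\<ge>s. Y x s \<omega> = 0 \<longrightarrow> Y x t \<omega> = 0"
    and f: "f \<in> borel_measurable borel" "f 0 = 0"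
    and "t \<ge> 0"
  shows "killed_semigroup P Y t f x = transition_semigroup P Y t f x"
proof -
  interpret complete_measure P
    by fact
  note [measurable] = meas f(1)
  let ?S = "{\<omega> \<in> space P. ereal t < hitting_time_zero (Y x) \<omega>}"
  have survival: "AE \<omega> in P. ereal t < hitting_time_zero (Y x) \<omega> \<longleftrightarrow> Y x t \<omega> \<noteq> 0"
    using absorbing
  proof (rule AE_mp, intro AE_I2 impI)
    fix \<omega> assume "\<omega> \<in> space P" "\<forall>s\<ge>0. \<forall>t\<ge>s. Y x s \<omega> = 0 \<longrightarrow> Y x t \<omega> = 0"
    then show "ereal t < hitting_time_zero (Y x) \<omega> \<longleftrightarrow> Y x t \<omega> \<noteq> 0"
      using \<open>t \<ge> 0\<close> by (intro less_hitting_time_zero_iff cadlag)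
  qed
  have "?S \<in> sets P"
  proof (rule in_sets_AE)
    show "AE \<omega> in P. \<omega> \<in> {\<omega> \<in> space P. Y x t \<omega> \<noteq> 0} \<longleftrightarrow> \<omega> \<in> ?S"
      using survival by (rule AE_mp) (auto intro!: AE_I2)
  qed auto
  have "killed_semigroup P Y t f x = (\<integral>\<omega>. indicator ?S \<omega> * f (Y x t \<omega>) \<partial>P)"
    unfolding killed_semigroup_def
    by (intro Bochner_Integration.integral_cong) (auto simp: indicator_def)
  also have "\<dots> = (\<integral>\<omega>. f (Y x t \<omega>) \<partial>P)"
  proof (rule integral_cong_AE)
    show "AE \<omega> in P. indicator ?S \<omega> * f (Y x t \<omega>) = f (Y x t \<omega>)"
      using survival by (rule AE_mp) (auto intro!: AE_I2 simp: indicator_def f(2))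
    show "(\<lambda>\<omega>. indicator ?S \<omega> * f (Y x t \<omega>)) \<in> borel_measurable P"
      using \<open>?S \<in> sets P\<close> by measurable
  qed measurable
  finally show ?thesis
    by (simp add: transition_semigroup_def)
qed

lemma transition_semigroup_0:
  assumes "prob_space P" "Y x 0 \<in> borel_measurable P" "AE \<omega> in P. Y x 0 \<omega> = x"
    and "f \<in> borel_measurable borel"
  shows "transition_semigroup P Y 0 f x = f x"
proof -
  interpret prob_space P
    by fact
  note [measurable] = assms(2,4)
  have "(\<integral>\<omega>. f (Y x 0 \<omega>) \<partial>P) = (\<integral>\<omega>. f x \<partial>P)"
    using assms(3) by (intro integral_cong_AE) auto
  then show ?thesis
    by (simp add: transition_semigroup_def prob_space)
qed

section \<open>The weak Feller property\<close>

theorem proposition1p6: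
  fixes P :: "'w measure" and F :: "real \<Rightarrow> 'w measure"
    and b c :: real and \<mu> :: "real measure" and g :: "real \<Rightarrow> real"
    and W :: "(real \<times> real) set \<Rightarrow> 'w \<Rightarrow> real"
    and M :: "'w \<Rightarrow> (real \<times> real \<times> real) measure"
    and Y :: "real \<Rightarrow> real \<Rightarrow> 'w \<Rightarrow> real"
  assumes parameters: "cbc_parameters c \<mu> g"
    and space: "prob_space P" "usual_hypotheses P F"
    and white_noise: "gaussian_white_noise P F leb_pos W"
    and poisson: "poisson_random_measure P F (\<mu> \<Otimes>\<^sub>M leb_pos) M"
    and cbc: "\<And>x. x \<ge> 0 \<Longrightarrow> cbc_unique_strong_solution P F b c \<mu> g W M x (Y x)"
    and absorbing: "\<And>x. x \<ge> 0 \<Longrightarrow>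
      AE \<omega> in P. \<forall>s\<ge>0. \<forall>t\<ge>s. Y x s \<omega> = 0 \<longrightarrow> Y x t \<omega> = 0"
    and strong_feller: "strong_feller (transition_semigroup P Y)"
  shows "weak_feller (killed_semigroup P Y)"
proof -
  have killed: "killed_semigroup P Y t f x = transition_semigroup P Y t f x"
    and start: "transition_semigroup P Y 0 f x = f x"
    if f: "f \<in> pos_test_functions" and "t \<ge> 0" "x > 0" for f t x
  proof -
    have sol: "cbc_solution P F b c \<mu> g W M x (Y x)"
      using cbc[of x] \<open>x > 0\<close> by (simp add: cbc_unique_strong_solution_def)
    have cadlag: "cadlag (\<lambda>t. Y x t \<omega>)" if "\<omega> \<in> space P" for \<omega>
      using cbc_solutionD(2)[OF sol] that by blast
    have meas: "Y x s \<in> borel_measurable P" if "s \<ge> 0" for s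
      using space(2) cbc_solutionD(1)[OF sol] that by (rule adapted_borel_measurable)
    note f_borel = pos_test_function_borel[OF f]
    show "killed_semigroup P Y t f x = transition_semigroup P Y t f x"
      using usual_hypotheses_complete[OF space(2)] meas[OF \<open>t \<ge> 0\<close>] cadlag
        absorbing[OF less_imp_le[OF \<open>x > 0\<close>]] f_borel pos_test_function_nonpos[OF f order_refl]
        \<open>t \<ge> 0\<close>
      by (rule killed_semigroup_eq_transition_semigroup)
    show "transition_semigroup P Y 0 f x = f x"
      using space(1) meas[OF order_refl] cbc_solutionD(3)[OF sol] f_borel by (rule transition_semigroup_0)
  qed
  have "continuous_on {0<..} (killed_semigroup P Y t f)"
    if f: "f \<in> pos_test_functions" and t: "t \<ge> 0" for f t
  proof (cases "t = 0")
    case True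
    have "continuous_on {0<..} f"
      using f by (simp add: pos_test_functions_def)
    then show ?thesis
    proof (rule continuous_on_eq)
      fix x :: real assume "x \<in> {0<..}"
      then show "f x = killed_semigroup P Y t f x"
        using killed[OF f t, of x] start[OF f t, of x] True by simp
    qed
  next
    case False
    have "f \<in> borel_measurable (restrict_space borel {0..})"
      using pos_test_function_borel[OF f] by (rule measurable_restrict_space1)
    moreover have "bounded (f ` {0..})"
      using pos_test_function_bounded[OF f] by (rule bounded_subset) auto
    ultimately have "continuous_on {0..} (transition_semigroup P Y t f)"
      using strong_feller t False by (simp add: strong_feller_def)
    then have "continuous_on {0<..} (transition_semigroup P Y t f)"
      by (rule continuous_on_subset) auto
    then show ?thesis
    proof (rule continuous_on_eq)
      fix x :: real assume "x \<in> {0<..}"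
      then show "transition_semigroup P Y t f x = killed_semigroup P Y t f x"
        using killed[OF f t, of x] by simp
    qed
  qed
  moreover have "\<forall>f\<in>pos_test_functions.
      continuous_on {0<..} f \<and> bounded (f ` {0<..}) \<and> closure {x. f x \<noteq> 0} \<subseteq> {0<..}"
    by (simp add: pos_test_functions_def)
  ultimately show ?thesis
    unfolding weak_feller_def using measure_separable_pos_test_functions by blast
qed

end
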